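(* For every integer $n\ge 0$ and every real $x$, $$\frac{1}{2}\bigg(\sum_{l=0}^{n}\binom{n}{l}\mathcal{E}_{l,\lambda}^{Y}(x)E\big[(Y)_{n-l,\lambda}\big]+\mathcal{E}_{n,\lambda}^{Y}(x)\bigg)=\sum_{k=0}^{n}\langle x\rangle_{k,\lambda}(-1)^{n-k}S_{1,\lambda}^{Y}(n,k)=\sum_{k=0}^{n}(x)_{k,\lambda}\sum_{m=k}^{n}S_{1,\lambda}(m,k){n \brace m}_{Y,\lambda}.$$
   Context: $\lambda$ is a fixed nonzero real number. For real $x$ and $n\ge1$: $(x)_{n}=x(x-1)\cdots(x-n+1)$, $(x)_{n,\lambda}=x(x-\lambda)\cdots(x-(n-1)\lambda)$, $\langle x\rangle_{n,\lambda}=x(x+\lambda)\cdots(x+(n-1)\lambda)$, and $(x)_0=(x)_{0,\lambda}=\langle x\rangle_{0,\lambda}=1$. The degenerate exponential is $e_{\lambda}^{x}(t)=(1+\lambda t)^{x/\lambda}=\sum_{n\ge0}(x)_{n,\lambda}\frac{t^n}{n!}$. The degenerate logarithm is, for $\mu\ne0$ and $u>0$, $\log_{\mu}(u)=\frac{1}{\mu}(u^{\mu}-1)$; in particular $\log_{-\lambda}(u)=-\frac1\lambda(u^{-\lambda}-1)$. The degenerate Stirling numbers of the first kind $S_{1,\lambda}(n,k)$ (no superscript) are defined by the polynomial identity $(x)_n=\sum_{k=0}^nS_{1,\lambda}(n,k)(x)_{k,\lambda}$, $n\ge0$; equivalently $\frac1{k!}(\log_\lambda(1+t))^k=\sum_{n\ge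 k}S_{1,\lambda}(n,k)\frac{t^n}{n!}$. $Y$ is a real random variable whose degenerate moment generating functions exist near the origin: for every nonzero real $\lambda$ there is $r=r(\lambda)>0$ with $E[e_{\lambda}^{Y}(t)]=\sum_{n\ge0}E[(Y)_{n,\lambda}]\frac{t^n}{n!}$ for $|t|<r$. All generating-function identities are power series expansions at $t=0$. Probabilistic degenerate Stirling numbers of the second kind: $\frac{1}{k!}\big(E[e_{\lambda}^{Y}(t)]-1\big)^k=\sum_{n\ge k}{n\brace k}_{Y,\lambda}\frac{t^n}{n!}$, $k\ge0$. Probabilistic degenerate Stirling numbers of the first kind: $\frac{1}{k!}\big(\log_{-\lambda}(E[e_{\lambda}^{Y}(t)])\big)^k=\sum_{n\ge k}(-1)^{n-k}S_{1,\lambda}^{Y}(n,k)\frac{t^n}{n!}$, $k\ge0$. Probabilistic degenerate Euler polynomials: $\frac{2}{E[e_{\lambda}^{Y}(t)]+1}\big(E[e_{\lambda}^{Y}(t)]\big)^{x}=\sum_{n\ge0}\mathcal{E}_{n,\lambda}^{Y}(x)\frac{t^n}{n!}$. *)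

theory Defs
  imports "HOL-Probability.Probability"
begin

subsection \<open>Degenerate factorials, exponential and logarithm\<close>

text \<open>\<open>degen_ffact lam x n\<close> is \<open>(x)\<^bsub>n,lam\<^esub>\<close>; the ordinary falling factorial \<open>(x)\<^sub>n\<close> is the case
  \<open>lam = 1\<close>.\<close>

definition degen_ffact :: "real \<Rightarrow> real \<Rightarrow> nat \<Rightarrow> real" where
  "degen_ffact lam x n = (\<Prod>i<n. x - real i * lam)"

definition degen_rfact :: "real \<Rightarrow> real \<Rightarrow> nat \<Rightarrow> real" where
  "degen_rfact lam x n = (\<Prod>i<n. x + real i * lam)"

text \<open>Only used where \<open>1 + lam * t > 0\<close>.\<close>

definition degen_exp :: "real \<Rightarrow> real \<Rightarrow> real \<Rightarrow> real" where
  "degen_exp lam x t = (1 + lam * t) powr (x / lam)"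

definition degen_log :: "real \<Rightarrow> real \<Rightarrow> real" where
  "degen_log mu u = (u powr mu - 1) / mu"


subsection \<open>Degenerate Stirling numbers of the first kind\<close>

text \<open>The clause for \<open>k > n\<close> only pads the finite coefficient sequence with zeros, so that it is
  determined as a function on all of \<open>nat\<close>.\<close>

definition degen_stirling1 :: "real \<Rightarrow> nat \<Rightarrow> nat \<Rightarrow> real" where
  "degen_stirling1 lam n =
     (THE s. (\<forall>x. degen_ffact 1 x n = (\<Sum>k\<le>n. s k * degen_ffact lam x k)) \<and> (\<forall>k>n. s k = 0))"

lemma degen_ffact_Suc: "degen_ffact lam x (Suc n) = degen_ffact lam x n * (x - real n * lam)"
  by (simp add: degen_ffact_def)

lemma degen_ffact_basis_unique:
  assumes lam: "lam \<noteq> 0" and eq: "\<And>x. (\<Sum>k\<le>n. s k * degen_ffact lam x k) = 0" and "k \<le> n"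
  shows "s k = 0"
  using \<open>k \<le> n\<close>
proof (induction k rule: less_induct)
  case (less k)
  have zero: "degen_ffact lam (real k * lam) j = 0" if "k < j" for j
    using that by (auto simp: degen_ffact_def)
  have nz: "degen_ffact lam (real k * lam) k \<noteq> 0"
    using lam by (auto simp: degen_ffact_def)
  have "(\<Sum>j\<le>n. s j * degen_ffact lam (real k * lam) j)
      = (\<Sum>j\<in>{k}. s j * degen_ffact lam (real k * lam) j)"
  proof (rule sum.mono_neutral_right)
    show "\<forall>i\<in>{..n} - {k}. s i * degen_ffact lam (real k * lam) i = 0"
    proof
      fix i assume i: "i \<in> {..n} - {k}"
      show "s i * degen_ffact lam (real k * lam) i = 0"
      proof (cases "i < k")
        case True
        then show ?thesis using less.IH[of i] i by simp
      next
        case False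
        then show ?thesis using zero[of i] i by simp
      qed
    qed
  qed (use less.prems in auto)
  then show ?case using eq[of "real k * lam"] nz by simp
qed

lemma degen_ffact_expansion_exists:
  "\<exists>s. (\<forall>x. degen_ffact 1 x n = (\<Sum>k\<le>n. s k * degen_ffact lam x k)) \<and> (\<forall>k>n. s k = 0)"
proof (induction n)
  case 0
  show ?case by (rule exI[of _ "\<lambda>k. if k = 0 then 1 else 0"]) (simp add: degen_ffact_def)
next
  case (Suc n)
  then obtain s where s: "\<And>x. degen_ffact 1 x n = (\<Sum>k\<le>n. s k * degen_ffact lam x k)"
    and s0: "\<And>k. k > n \<Longrightarrow> s k = 0" by blast
  define s' where "s' k = (if k = 0 then 0 else s (k - 1)) + s k * (real k * lam - real n)" for k
  have "degen_ffact 1 x (Suc n) = (\<Sum>k\<le>Suc n. s' k * degen_ffact lam x k)" for x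
  proof -
    have "degen_ffact 1 x (Suc n) = (\<Sum>k\<le>n. s k * degen_ffact lam x k * (x - real n))"
      by (simp add: degen_ffact_Suc s sum_distrib_right)
    also have "\<dots> = (\<Sum>k\<le>n. s k * degen_ffact lam x (Suc k)
                     + s k * (real k * lam - real n) * degen_ffact lam x k)"
      by (intro sum.cong refl) (simp add: degen_ffact_Suc algebra_simps)
    also have "\<dots> = (\<Sum>k\<le>n. s k * degen_ffact lam x (Suc k))
                    + (\<Sum>k\<le>Suc n. s k * (real k * lam - real n) * degen_ffact lam x k)"
      by (simp add: sum.distrib s0)
    also have "(\<Sum>k\<le>n. s k * degen_ffact lam x (Suc k))
        = (\<Sum>k\<le>Suc n. (if k = 0 then 0 else s (k - 1)) * degen_ffact lam x k)"
      by (simp add: sum.atMost_Suc_shift del: sum.atMost_Suc)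
    finally show ?thesis
      by (simp add: s'_def sum.distrib ring_distribs del: sum.atMost_Suc)
  qed
  moreover have "s' k = 0" if "k > Suc n" for k
    using that s0[of k] s0[of "k - 1"] by (simp add: s'_def)
  ultimately show ?case by blast
qed

lemma degen_stirling1_unique:
  assumes "lam \<noteq> 0"
  shows "\<exists>!s. (\<forall>x. degen_ffact 1 x n = (\<Sum>k\<le>n. s k * degen_ffact lam x k)) \<and> (\<forall>k>n. s k = 0)"
proof (rule ex_ex1I[OF degen_ffact_expansion_exists])
  fix s s'
  assume s: "(\<forall>x. degen_ffact 1 x n = (\<Sum>k\<le>n. s k * degen_ffact lam x k)) \<and> (\<forall>k>n. s k = 0)"
    and s': "(\<forall>x. degen_ffact 1 x n = (\<Sum>k\<le>n. s' k * degen_ffact lam x k)) \<and> (\<forall>k>n. s' k = 0)"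
  have "(\<Sum>k\<le>n. (s k - s' k) * degen_ffact lam x k) = 0" for x
    using s[THEN conjunct1, rule_format, of x] s'[THEN conjunct1, rule_format, of x]
    by (simp add: left_diff_distrib sum_subtractf)
  then have "s k - s' k = 0" if "k \<le> n" for k
    using degen_ffact_basis_unique[OF assms, where n = n and s = "\<lambda>k. s k - s' k" and k = k] that by blast
  then show "s = s'" using s s' by (metis eq_iff_diff_eq_0 ext not_le)
qed

lemma degen_stirling1:
  assumes "lam \<noteq> 0"
  shows "degen_ffact 1 x n = (\<Sum>k\<le>n. degen_stirling1 lam n k * degen_ffact lam x k)"
  using theI'[OF degen_stirling1_unique[OF assms, of n]] unfolding degen_stirling1_def by blast


subsection \<open>Coefficients of exponential generating functions\<close>

text \<open>\<open>egf_coeff f n\<close> is the \<open>a n\<close> in the expansion \<open>f t = (\<Sum>n. a n * t ^ n / fact n)\<close>, valid for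
  \<open>t\<close> near \<open>0\<close>; it is meaningful only if \<open>f\<close> has such an expansion.\<close>

definition egf_coeff :: "(real \<Rightarrow> real) \<Rightarrow> nat \<Rightarrow> real" where
  "egf_coeff f n = fact n * fps_nth (THE F. f has_fps_expansion F) n"

lemma has_fps_expansion_unique_real:
  fixes f :: "real \<Rightarrow> real"
  assumes F: "f has_fps_expansion F" and G: "f has_fps_expansion G"
  shows "F = G"
proof (rule ccontr)
  assume "F \<noteq> G"
  define H where "H = F - G"
  have "H \<noteq> 0" using \<open>F \<noteq> G\<close> by (simp add: H_def)
  have "(\<lambda>t. f t - f t) has_fps_expansion H"
    unfolding H_def using F G by (rule fps_expansion_intros)
  then have rad: "fps_conv_radius H > 0" and ev: "eventually (\<lambda>t. eval_fps H t = 0) (nhds 0)"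
    by (auto simp: has_fps_expansion_def)
  define m where "m = subdegree H"
  define K where "K = fps_shift m H"
  have HK: "H = K * fps_X ^ m" and K0: "fps_nth K 0 \<noteq> 0"
    using \<open>H \<noteq> 0\<close> by (simp_all add: K_def m_def subdegree_decompose[symmetric])
  have radK: "fps_conv_radius K > 0" using rad by (simp add: K_def)
  have "continuous_on (eball 0 (fps_conv_radius K)) (eval_fps K)"
    by (intro continuous_on_eval_fps)
  then have "isCont (eval_fps K) 0"
    using radK by (subst (asm) continuous_on_eq_continuous_at) (auto simp: zero_ereal_def)
  then have "(eval_fps K \<longlongrightarrow> eval_fps K 0) (at 0)" by (simp add: isCont_def)
  then have nz: "eventually (\<lambda>t. eval_fps K t \<noteq> 0) (at 0)"
    by (rule tendsto_imp_eventually_ne) (use K0 in \<open>simp add: eval_fps_at_0\<close>)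
  have "eventually (\<lambda>t. t \<in> eball 0 (fps_conv_radius K)) (nhds (0::real))"
    using radK by (intro eventually_nhds_in_open) (auto simp: zero_ereal_def)
  with ev have "eventually (\<lambda>t. eval_fps H t = 0 \<and> t \<in> eball 0 (fps_conv_radius K)) (at 0)"
    by (auto simp: eventually_at_filter elim: eventually_elim2)
  moreover have "eventually (\<lambda>t::real. t \<noteq> 0) (at 0)" by (simp add: eventually_at_filter)
  ultimately have "eventually (\<lambda>t::real. False) (at 0)"
    using nz
  proof eventually_elim
    case (elim t)
    then have "eval_fps H t = eval_fps K t * t ^ m"
      unfolding HK by (subst eval_fps_mult) auto
    then show ?case using elim by simp
  qed
  then show False by simp
qed

lemma egf_coeff_eq:
  assumes "f has_fps_expansion F"
  shows "egf_coeff f n = fact n * fps_nth F n"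
proof -
  have "(THE F. f has_fps_expansion F) = F"
    using assms has_fps_expansion_unique_real by blast
  then show ?thesis by (simp add: egf_coeff_def)
qed


subsection \<open>Probabilistic degenerate numbers and polynomials\<close>

definition degen_moment :: "'a measure \<Rightarrow> ('a \<Rightarrow> real) \<Rightarrow> real \<Rightarrow> nat \<Rightarrow> real" where
  "degen_moment M Y lam n = (\<integral>\<omega>. degen_ffact lam (Y \<omega>) n \<partial>M)"

definition degen_mgf :: "'a measure \<Rightarrow> ('a \<Rightarrow> real) \<Rightarrow> real \<Rightarrow> real \<Rightarrow> real" where
  "degen_mgf M Y lam t = (\<integral>\<omega>. degen_exp lam (Y \<omega>) t \<partial>M)"

text \<open>The integrability clauses say that the expectations exist, since the Bochner integral of a
  non-integrable function is \<open>0\<close> by convention; \<open>r * \<bar>lam\<bar> \<le> 1\<close> keeps \<open>1 + lam * t\<close> positive.\<close>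

definition degen_mgfs_exist :: "'a measure \<Rightarrow> ('a \<Rightarrow> real) \<Rightarrow> bool" where
  "degen_mgfs_exist M Y \<longleftrightarrow>
     (\<forall>lam. lam \<noteq> 0 \<longrightarrow>
        (\<forall>n. integrable M (\<lambda>\<omega>. degen_ffact lam (Y \<omega>) n)) \<and>
        (\<exists>r>0. r * \<bar>lam\<bar> \<le> 1 \<and>
           (\<forall>t. \<bar>t\<bar> < r \<longrightarrow>
              integrable M (\<lambda>\<omega>. degen_exp lam (Y \<omega>) t) \<and>
              (\<lambda>n. degen_moment M Y lam n * t ^ n / fact n) sums degen_mgf M Y lam t)))"

definition prob_degen_stirling2 ::
    "'a measure \<Rightarrow> ('a \<Rightarrow> real) \<Rightarrow> real \<Rightarrow> nat \<Rightarrow> nat \<Rightarrow> real" where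
  "prob_degen_stirling2 M Y lam n k =
     egf_coeff (\<lambda>t. 1 / fact k * (degen_mgf M Y lam t - 1) ^ k) n"

text \<open>The generating function has coefficients \<open>(-1) ^ (n - k) * prob_degen_stirling1 M Y lam n k\<close>;
  the sign is its own inverse. Only \<open>k \<le> n\<close> is of interest.\<close>

definition prob_degen_stirling1 ::
    "'a measure \<Rightarrow> ('a \<Rightarrow> real) \<Rightarrow> real \<Rightarrow> nat \<Rightarrow> nat \<Rightarrow> real" where
  "prob_degen_stirling1 M Y lam n k =
     (-1) ^ (n - k) * egf_coeff (\<lambda>t. 1 / fact k * degen_log (- lam) (degen_mgf M Y lam t) ^ k) n"

definition prob_degen_euler ::
    "'a measure \<Rightarrow> ('a \<Rightarrow> real) \<Rightarrow> real \<Rightarrow> nat \<Rightarrow> real \<Rightarrow> real" where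
  "prob_degen_euler M Y lam n x =
     egf_coeff (\<lambda>t. 2 / (degen_mgf M Y lam t + 1) * degen_mgf M Y lam t powr x) n"

end

theory Submission
  imports Defs "HOL-Complex_Analysis.Laurent_Convergence"
begin

text \<open>All three expressions are the coefficient of \<open>t\<^sup>n/n!\<close> in \<open>G(t)\<^sup>x\<close>, where \<open>G(t)\<close> is the degenerate
  moment generating function. The first comes from \<open>(G + 1)/2 \<cdot> 2/(G + 1) \<cdot> G\<^sup>x = G\<^sup>x\<close>. The other two
  come from the binomial series of \<open>(1 - \<lambda> L)\<close> to the power \<open>-x/\<lambda>\<close>, with \<open>L\<close> the degenerate logarithm
  \<open>log\<^bsub>-\<lambda>\<^esub> G\<close>, and of \<open>(1 + (G - 1))\<close> to the power \<open>x\<close>.\<close>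

subsection \<open>Composition of real power series\<close>

text \<open>The library composes convergent power series over the complex numbers only, so real series are
  extended to complex arguments and the result is restricted to the real axis.\<close>

definition fps_complex :: "real fps \<Rightarrow> complex fps" where
  "fps_complex F = Abs_fps (\<lambda>n. of_real (fps_nth F n))"

lemma fps_complex_nth [simp]: "fps_nth (fps_complex F) n = of_real (fps_nth F n)"
  by (simp add: fps_complex_def)

lemma fps_complex_1 [simp]: "fps_complex 1 = 1"
  by (simp add: fps_eq_iff)

lemma fps_complex_mult: "fps_complex (F * G) = fps_complex F * fps_complex G"
  by (simp add: fps_eq_iff fps_mult_nth)

lemma fps_complex_power: "fps_complex (F ^ n) = fps_complex F ^ n"
  by (induction n) (simp_all add: fps_complex_mult)

text \<open>Each coefficient of a formal composition is a finite sum of products of coefficients,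
  and \<open>of_real\<close> is a ring homomorphism.\<close>

lemma fps_complex_compose: "fps_complex (F oo G) = fps_complex F oo fps_complex G"
  by (simp add: fps_eq_iff fps_compose_nth flip: fps_complex_power)

lemma fps_conv_radius_complex [simp]: "fps_conv_radius (fps_complex F) = fps_conv_radius F"
  by (simp add: fps_conv_radius_def conv_radius_def)

lemma eval_fps_complex:
  assumes "ereal \<bar>x\<bar> < fps_conv_radius F"
  shows "eval_fps (fps_complex F) (of_real x) = of_real (eval_fps F x)"
proof -
  have "(\<lambda>n. fps_nth F n * x ^ n) sums eval_fps F x"
    using assms by (intro sums_eval_fps) simp
  then have "(\<lambda>n. of_real (fps_nth F n * x ^ n) :: complex) sums of_real (eval_fps F x)"
    by (simp only: sums_of_real_iff)
  then show ?thesis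
    by (simp add: eval_fps_def sums_iff)
qed

lemma eventually_in_conv_radius:
  fixes F :: "real fps"
  assumes "fps_conv_radius F > 0"
  shows "eventually (\<lambda>x. ereal \<bar>x\<bar> < fps_conv_radius F) (nhds 0)"
proof -
  have "eventually (\<lambda>x. x \<in> eball 0 (fps_conv_radius F)) (nhds (0 :: real))"
    using assms by (intro eventually_nhds_in_open) (auto simp: zero_ereal_def)
  then show ?thesis by (simp add: in_eball_iff)
qed

lemma has_fps_expansion_imp_tendsto:
  fixes f :: "real \<Rightarrow> real"
  assumes "f has_fps_expansion F"
  shows "(f \<longlongrightarrow> fps_nth F 0) (nhds 0)"
proof -
  \<comment> \<open>A property that holds eventually in \<open>nhds 0\<close> also holds at the
    point 0 itself, so the value there is the constant term.\<close>
  have "f 0 = fps_nth F 0"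
    using assms by (auto simp: has_fps_expansion_def eval_fps_at_0 dest: eventually_nhds_x_imp_x)
  then show ?thesis
    using has_fps_expansion_imp_continuous[OF assms, of UNIV]
    by (metis continuous_within tendsto_at_iff_tendsto_nhds)
qed

text \<open>Both series are evaluated at complex arguments and composed there; at real points near 0
  the complex values are the embedded real ones, and injectivity of \<open>of_real\<close> brings
  the identity back.\<close>

lemma has_fps_expansion_compose_real:
  fixes f g :: "real \<Rightarrow> real"
  assumes f: "f has_fps_expansion F" and g: "g has_fps_expansion G" and G0: "fps_nth G 0 = 0"
  shows "(\<lambda>t. f (g t)) has_fps_expansion (F oo G)"
proof -
  have rF: "fps_conv_radius F > 0" and evF: "eventually (\<lambda>t. eval_fps F t = f t) (nhds 0)"
    and rG: "fps_conv_radius G > 0" and evG: "eventually (\<lambda>t. eval_fps G t = g t) (nhds 0)"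
    using f g by (auto simp: has_fps_expansion_def)
  have comp: "(eval_fps (fps_complex F) \<circ> eval_fps (fps_complex G)) has_fps_expansion
      fps_complex (F oo G)"
    unfolding fps_complex_compose using rF rG G0
    by (intro has_fps_expansion_compose eval_fps_has_fps_expansion) simp_all
  have rFG: "fps_conv_radius (F oo G) > 0"
    using comp by (simp add: has_fps_expansion_def)
  \<comment> \<open>Pulls a neighbourhood of 0 in the complex plane back to one on the real
    line.\<close>
  have lim: "filterlim complex_of_real (nhds 0) (nhds 0)"
    using isCont_of_real[OF continuous_ident, of "0 :: real"]
    by (metis continuous_at of_real_0 continuous_within tendsto_at_iff_tendsto_nhds)
  have ev1: "eventually (\<lambda>t. eval_fps (fps_complex (F oo G)) (complex_of_real t)
      = eval_fps (fps_complex F) (eval_fps (fps_complex G) (of_real t))) (nhds 0)"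
    using comp eventually_compose_filterlim[OF _ lim]
    by (auto simp: has_fps_expansion_def)
  have limg: "filterlim g (nhds 0) (nhds 0)"
    using has_fps_expansion_imp_tendsto[OF g] G0 by simp
  have "eventually (\<lambda>t. eval_fps (F oo G) t = f (g t)) (nhds 0)"
    \<comment> \<open>Three points must lie within a radius of convergence: \<open>t\<close> for
      \<open>F oo G\<close> and for \<open>G\<close>, and \<open>g t\<close> for \<open>F\<close>.
      The last holds near 0 because \<open>g\<close> tends to 0.\<close>
    using ev1 eventually_in_conv_radius[OF rFG] eventually_in_conv_radius[OF rG] evG
      eventually_compose_filterlim[OF evF limg]
      eventually_compose_filterlim[OF eventually_in_conv_radius[OF rF] limg]
  proof eventually_elim
    case (elim t)
    have "complex_of_real (eval_fps (F oo G) t) = of_real (eval_fps F (g t))"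
      using elim by (simp add: eval_fps_complex)
    then show ?case using elim by simp
  qed
  with rFG show ?thesis by (simp add: has_fps_expansion_def)
qed

lemma has_fps_expansion_binomial_real: "(\<lambda>x::real. (1 + x) powr a) has_fps_expansion fps_binomial a"
proof (rule has_fps_expansionI)
  have "eventually (\<lambda>x. x \<in> ball 0 1) (nhds (0 :: real))"
    by (intro eventually_nhds_in_open) auto
  then show "eventually (\<lambda>x. (\<lambda>n. fps_nth (fps_binomial a) n * x ^ n) sums (1 + x) powr a) (nhds 0)"
    by eventually_elim (use gen_binomial_real[of _ a] in auto)
qed

lemma has_fps_expansion_powr:
  assumes "f has_fps_expansion F" "fps_nth F 0 = 0"
  shows "(\<lambda>t::real. (1 + f t) powr a) has_fps_expansion (fps_binomial a oo F)"
  using has_fps_expansion_compose_real[OF has_fps_expansion_binomial_real assms] .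

subsection \<open>Operations on exponential generating functions\<close>

lemma egf_coeff_cong:
  assumes "eventually (\<lambda>t. f t = g t) (nhds 0)"
  shows "egf_coeff f n = egf_coeff g n"
proof -
  have "(f has_fps_expansion F) = (g has_fps_expansion F)" for F
    using has_fps_expansion_cong[OF assms refl] .
  then show ?thesis unfolding egf_coeff_def by presburger
qed

lemma egf_coeff_cmult:
  assumes "f has_fps_expansion F"
  shows "egf_coeff (\<lambda>t. c * f t) n = c * egf_coeff f n"
  unfolding egf_coeff_eq[OF has_fps_expansion_cmult_left[OF assms]] egf_coeff_eq[OF assms] by simp

lemma egf_coeff_add:
  assumes "f has_fps_expansion F" "g has_fps_expansion G"
  shows "egf_coeff (\<lambda>t. f t + g t) n = egf_coeff f n + egf_coeff g n"
  unfolding egf_coeff_eq[OF has_fps_expansion_add[OF assms]] egf_coeff_eq[OF assms(1)]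
    egf_coeff_eq[OF assms(2)] by (simp add: distrib_left)

lemma egf_coeff_mult:
  assumes f: "f has_fps_expansion F" and g: "g has_fps_expansion G"
  shows "egf_coeff (\<lambda>t. f t * g t) n
      = (\<Sum>l=0..n. real (n choose l) * egf_coeff f l * egf_coeff g (n - l))"
  unfolding egf_coeff_eq[OF f] egf_coeff_eq[OF g] egf_coeff_eq[OF has_fps_expansion_mult[OF f g]]
    fps_mult_nth sum_distrib_left
  by (intro sum.cong refl) (simp add: binomial_fact)

text \<open>Binomial series in \<open>f\<close>. The factor \<open>fact k\<close> is split off so
  that the remaining \<open>1 / fact k * f t ^ k\<close> is the shape of the generating functions
  that define both kinds of Stirling numbers.\<close>

lemma egf_coeff_powr:
  assumes f: "f has_fps_expansion F" and F0: "fps_nth F 0 = 0"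
  shows "egf_coeff (\<lambda>t. (1 + f t) powr a) n
      = (\<Sum>k=0..n. fact k * (a gchoose k) * egf_coeff (\<lambda>t. 1 / fact k * f t ^ k) n)"
proof -
  have "egf_coeff (\<lambda>t. 1 / fact k * f t ^ k) n = 1 / fact k * (fact n * fps_nth (F ^ k) n)" for k
    unfolding egf_coeff_cmult[OF has_fps_expansion_power[OF f]]
      egf_coeff_eq[OF has_fps_expansion_power[OF f]] by (rule refl)
  then show ?thesis
    unfolding egf_coeff_eq[OF has_fps_expansion_powr[OF f F0]] fps_compose_nth sum_distrib_left
    by (intro sum.cong refl) simp
qed

subsection \<open>Degenerate factorials\<close>

lemma degen_ffact_1_gbinomial: "degen_ffact 1 x k = fact k * (x gchoose k)"
  by (simp add: degen_ffact_def gbinomial_prod_rev atLeast0LessThan)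

text \<open>Factor by factor, x + i lam = (- x / lam - i) (- lam).\<close>

lemma degen_rfact_gbinomial:
  assumes "lam \<noteq> 0"
  shows "degen_rfact lam x k = fact k * ((- x / lam) gchoose k) * (- lam) ^ k"
proof -
  have "degen_rfact lam x k = (\<Prod>i<k. (- x / lam - real i) * (- lam))"
    unfolding degen_rfact_def using assms by (intro prod.cong refl) (simp add: field_simps)
  then show ?thesis
    by (simp only: prod.distrib) (simp add: gbinomial_prod_rev atLeast0LessThan)
qed

text \<open>Exchanging the sums over the triangle k \<le> m \<le> n leaves, for each m, the
  expansion of \<open>degen_ffact 1 x m\<close> that defines
  \<open>degen_stirling1 lam m\<close>.\<close>

lemma sum_degen_ffact_stirling:
  assumes "lam \<noteq> 0"
  shows "(\<Sum>k=0..n. degen_ffact lam x k * (\<Sum>m=k..n. degen_stirling1 lam m k * c m))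
    = (\<Sum>m=0..n. degen_ffact 1 x m * c m)"
proof -
  have "(\<Sum>k=0..n. degen_ffact lam x k * (\<Sum>m=k..n. degen_stirling1 lam m k * c m))
      = (\<Sum>m=0..n. \<Sum>k=0..m. degen_ffact lam x k * (degen_stirling1 lam m k * c m))"
    unfolding sum_distrib_left sum.Sigma[OF finite_atLeastAtMost ballI[OF finite_atLeastAtMost]]
    by (rule sum.reindex_bij_witness[where i = "\<lambda>(m, k). (k, m)" and j = "\<lambda>(k, m). (m, k)"]) auto
  then show ?thesis
    by (simp add: degen_stirling1[OF assms] sum_distrib_left atMost_atLeast0 mult_ac)
qed

subsection \<open>The degenerate moment generating function\<close>

definition degen_mgf_fps :: "'a measure \<Rightarrow> ('a \<Rightarrow> real) \<Rightarrow> real \<Rightarrow> real fps" where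
  "degen_mgf_fps M Y lam = Abs_fps (\<lambda>n. degen_moment M Y lam n / fact n)"

context
  fixes M :: "'a measure" and Y :: "'a \<Rightarrow> real" and lam :: real
  assumes prob: "prob_space M" and mgf: "degen_mgfs_exist M Y" and lam: "lam \<noteq> 0"
begin

lemma has_fps_expansion_degen_mgf: "degen_mgf M Y lam has_fps_expansion degen_mgf_fps M Y lam"
proof (rule has_fps_expansionI)
  obtain r where r: "r > 0" "\<And>t. \<bar>t\<bar> < r \<Longrightarrow>
      (\<lambda>n. degen_moment M Y lam n * t ^ n / fact n) sums degen_mgf M Y lam t"
    using mgf lam unfolding degen_mgfs_exist_def by blast
  have "eventually (\<lambda>t. t \<in> ball 0 r) (nhds (0 :: real))"
    using r(1) by (intro eventually_nhds_in_open) auto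
  then show "eventually (\<lambda>t. (\<lambda>n. fps_nth (degen_mgf_fps M Y lam) n * t ^ n)
      sums degen_mgf M Y lam t) (nhds 0)"
    by eventually_elim (use r(2) in \<open>auto simp: degen_mgf_fps_def\<close>)
qed

text \<open>The moment of order 0 is the total mass of \<open>M\<close>. Hence G - 1 has no constant
  term and may be substituted into a power series.\<close>

lemma degen_mgf_fps_0: "fps_nth (degen_mgf_fps M Y lam) 0 = 1"
  using prob by (simp add: degen_mgf_fps_def degen_moment_def degen_ffact_def prob_space.prob_space)

lemma egf_coeff_degen_mgf: "egf_coeff (degen_mgf M Y lam) n = degen_moment M Y lam n"
  by (simp add: egf_coeff_eq[OF has_fps_expansion_degen_mgf] degen_mgf_fps_def)

lemma has_fps_expansion_degen_mgf_minus_1: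
  "(\<lambda>t. degen_mgf M Y lam t - 1) has_fps_expansion (degen_mgf_fps M Y lam - 1)"
  by (intro has_fps_expansion_diff has_fps_expansion_degen_mgf has_fps_expansion_1)

lemma has_fps_expansion_degen_mgf_powr:
  "(\<lambda>t. degen_mgf M Y lam t powr a) has_fps_expansion
    (fps_binomial a oo (degen_mgf_fps M Y lam - 1))"
  using has_fps_expansion_powr[OF has_fps_expansion_degen_mgf_minus_1, of a]
  by (simp add: degen_mgf_fps_0)

text \<open>G is continuous at 0 with value 1. Near 0 this keeps the denominator G + 1 of the Euler
  generating function away from zero.\<close>

lemma eventually_degen_mgf_pos: "eventually (\<lambda>t. degen_mgf M Y lam t > 0) (nhds 0)"
  using has_fps_expansion_imp_tendsto[OF has_fps_expansion_degen_mgf]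
  by (rule order_tendstoD) (simp add: degen_mgf_fps_0)

lemma egf_coeff_powr_stirling2:
  "egf_coeff (\<lambda>t. degen_mgf M Y lam t powr x) n
    = (\<Sum>m=0..n. degen_ffact 1 x m * prob_degen_stirling2 M Y lam n m)"
  using egf_coeff_powr[OF has_fps_expansion_degen_mgf_minus_1, of x n]
  by (simp add: degen_mgf_fps_0 degen_ffact_1_gbinomial prob_degen_stirling2_def)

lemma egf_coeff_powr_stirling1:
  "egf_coeff (\<lambda>t. degen_mgf M Y lam t powr x) n
    = (\<Sum>k=0..n. degen_rfact lam x k * (-1) ^ (n - k) * prob_degen_stirling1 M Y lam n k)"
proof -
  define L where "L t = degen_log (- lam) (degen_mgf M Y lam t)" for t
  \<comment> \<open>The series of \<open>L\<close>, since dividing by the parameter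
    \<open>- lam\<close> of the logarithm is multiplying by \<open>- 1 / lam\<close>. The binomial
    series starts with 1, so \<open>FL\<close> has constant term 0.\<close>
  define FL where "FL = fps_const (- 1 / lam) *
    ((fps_binomial (- lam) oo (degen_mgf_fps M Y lam - 1)) - 1)"
  have "(\<lambda>t. (- 1 / lam) * (degen_mgf M Y lam t powr (- lam) - 1)) has_fps_expansion FL"
    unfolding FL_def
    by (intro has_fps_expansion_cmult_left has_fps_expansion_diff has_fps_expansion_degen_mgf_powr
        has_fps_expansion_1)
  moreover have "(\<lambda>t. (- 1 / lam) * (degen_mgf M Y lam t powr (- lam) - 1)) = L"
    by (simp add: fun_eq_iff L_def degen_log_def field_simps lam)
  ultimately have L: "L has_fps_expansion FL" by simp
  have FL0: "fps_nth FL 0 = 0" by (simp add: FL_def)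
  have scaled: "(\<lambda>t. - lam * L t) has_fps_expansion (fps_const (- lam) * FL)"
    by (intro has_fps_expansion_cmult_left L)
  have "eventually (\<lambda>t. degen_mgf M Y lam t powr x = (1 + - lam * L t) powr (- x / lam)) (nhds 0)"
    using eventually_degen_mgf_pos
  proof eventually_elim
    case (elim t)
    \<comment> \<open>Inverts the degenerate logarithm; raising to the power
      \<open>- x / lam\<close> then gives the exponent (- lam) (- x / lam) = x.\<close>
    have "1 + - lam * L t = degen_mgf M Y lam t powr (- lam)"
      using lam by (simp add: L_def degen_log_def)
    then show ?case using lam by (simp add: powr_powr)
  qed
  then have "egf_coeff (\<lambda>t. degen_mgf M Y lam t powr x) n
      = egf_coeff (\<lambda>t. (1 + - lam * L t) powr (- x / lam)) n"
    by (rule egf_coeff_cong)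
  also have "\<dots> = (\<Sum>k=0..n. fact k * ((- x / lam) gchoose k)
      * egf_coeff (\<lambda>t. 1 / fact k * (- lam * L t) ^ k) n)"
    by (rule egf_coeff_powr[OF scaled]) (simp add: FL0)
  also have "\<dots> = (\<Sum>k=0..n. degen_rfact lam x k * (-1) ^ (n - k) * prob_degen_stirling1 M Y lam n k)"
  proof (intro sum.cong refl)
    fix k
    have E: "(\<lambda>t. 1 / fact k * L t ^ k) has_fps_expansion (fps_const (1 / fact k) * FL ^ k)"
      by (intro has_fps_expansion_cmult_left has_fps_expansion_power L)
    \<comment> \<open>The extracted power of \<open>- lam\<close> is the one that turns the
      generalized binomial coefficient into \<open>degen_rfact lam x k\<close>.\<close>
    have "egf_coeff (\<lambda>t. 1 / fact k * (- lam * L t) ^ k) n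
        = egf_coeff (\<lambda>t. (- lam) ^ k * (1 / fact k * L t ^ k)) n"
      by (simp only: power_mult_distrib mult_ac)
    also have "\<dots> = (- lam) ^ k * egf_coeff (\<lambda>t. 1 / fact k * L t ^ k) n"
      by (rule egf_coeff_cmult[OF E])
    \<comment> \<open>The sign (-1)^(n - k) occurs once here and once inside
      \<open>prob_degen_stirling1\<close>; the two multiply to 1.\<close>
    finally show "fact k * ((- x / lam) gchoose k) * egf_coeff (\<lambda>t. 1 / fact k * (- lam * L t) ^ k) n
        = degen_rfact lam x k * (-1) ^ (n - k) * prob_degen_stirling1 M Y lam n k"
      by (simp add: degen_rfact_gbinomial[OF lam] prob_degen_stirling1_def L_def
          flip: power_add mult_2)
  qed
  finally show ?thesis .
qed

lemma egf_coeff_powr_euler: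
  "egf_coeff (\<lambda>t. degen_mgf M Y lam t powr x) n
    = 1 / 2 * ((\<Sum>l=0..n. real (n choose l) * prob_degen_euler M Y lam l x
        * degen_moment M Y lam (n - l)) + prob_degen_euler M Y lam n x)"
proof -
  let ?G = "degen_mgf M Y lam" and ?F = "degen_mgf_fps M Y lam"
  define P where "P t = 2 / (?G t + 1) * ?G t powr x" for t
  define FP where "FP = 2 / (?F + 1) * (fps_binomial x oo (?F - 1))"
  have P: "P has_fps_expansion FP"
    unfolding P_def FP_def
    \<comment> \<open>The division is legitimate because the denominator series has constant term 1
      + 1 = 2.\<close>
    by (intro has_fps_expansion_mult has_fps_expansion_divide' has_fps_expansion_add
        has_fps_expansion_degen_mgf has_fps_expansion_degen_mgf_powr has_fps_expansion_1
        has_fps_expansion_numeral) (simp add: degen_mgf_fps_0)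
  have PG: "(\<lambda>t. P t * ?G t) has_fps_expansion FP * ?F"
    by (intro has_fps_expansion_mult P has_fps_expansion_degen_mgf)
  have "eventually (\<lambda>t. ?G t powr x = 1 / 2 * (P t * ?G t + P t)) (nhds 0)"
    using eventually_degen_mgf_pos
    by eventually_elim (simp add: P_def divide_simps, simp add: algebra_simps)
  then have "egf_coeff (\<lambda>t. ?G t powr x) n = egf_coeff (\<lambda>t. 1 / 2 * (P t * ?G t + P t)) n"
    by (rule egf_coeff_cong)
  also have "\<dots> = 1 / 2 * (egf_coeff (\<lambda>t. P t * ?G t) n + egf_coeff P n)"
    unfolding egf_coeff_cmult[OF has_fps_expansion_add[OF PG P]] egf_coeff_add[OF PG P] by (rule refl)
  finally show ?thesis
    unfolding egf_coeff_mult[OF P has_fps_expansion_degen_mgf]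
    by (simp add: egf_coeff_degen_mgf prob_degen_euler_def P_def[abs_def])
qed

end

theorem theorem2p12:
  fixes M :: "'a measure" and Y :: "'a \<Rightarrow> real" and lam x :: real and n :: nat
  assumes "prob_space M"
    and "Y \<in> borel_measurable M"
    and "degen_mgfs_exist M Y"
    and "lam \<noteq> 0"
  shows "1 / 2 * ((\<Sum>l=0..n. real (n choose l) * prob_degen_euler M Y lam l x
                     * degen_moment M Y lam (n - l)) + prob_degen_euler M Y lam n x)
           = (\<Sum>k=0..n. degen_rfact lam x k * (-1) ^ (n - k) * prob_degen_stirling1 M Y lam n k)
       \<and> (\<Sum>k=0..n. degen_rfact lam x k * (-1) ^ (n - k) * prob_degen_stirling1 M Y lam n k)
           = (\<Sum>k=0..n. degen_ffact lam x k
                * (\<Sum>m=k..n. degen_stirling1 lam m k * prob_degen_stirling2 M Y lam n m))"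
  \<comment> \<open>Collapsing the double sum first gives the third expression the form in
    \<open>egf_coeff_powr_stirling2\<close>.\<close>
  unfolding sum_degen_ffact_stirling[OF assms(4)]
    egf_coeff_powr_euler[OF assms(1,3,4), symmetric]
    egf_coeff_powr_stirling1[OF assms(1,3,4), symmetric]
    egf_coeff_powr_stirling2[OF assms(1,3,4), symmetric]
  by simp

end
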